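(* Let $N\ge 2$ and $m\ge 1$ be integers and let $x^{(r,s)}_k$ ($1\le r,s\le N$, $1\le k\le m$) be elements of a commutative ring; set $x^{(r,s)}_{m+1}=0$ for all $1\le r,s\le N$. Let $B(N,m)$ be the $Nm\times Nm$ matrix which, as an $N\times N$ block matrix with $m\times m$ blocks, has $(r,s)$ block $B_m(x^{(r,s)}_1,\dots,x^{(r,s)}_m)$. Then $$\det(B(N,m))=\prod_{i=1}^{m}\det(X_{(i,i+1)}).$$
   Context: For elements $x_1,\dots,x_m$, $B_m(x_1,\dots,x_m)$ is the $m\times m$ matrix whose $(p,q)$ entry is $x_{\max(p,q)}$ (top-left entry $x_1$, last row and column constantly $x_m$). For $1\le i\le m$, $X_{(i,i+1)}$ is the $N\times N$ matrix whose $(r,s)$ entry is $x^{(r,s)}_i-x^{(r,s)}_{i+1}$. *)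

theory Defs
  imports "Jordan_Normal_Form.Determinant"
begin

text \<open>
  The library type \<open>mat\<close> indexes rows and columns from 0, whereas the families
  \<open>x r s k\<close> are indexed from 1 in all three arguments; hence the \<open>Suc\<close>s below.
\<close>

definition B_mat :: "nat \<Rightarrow> (nat \<Rightarrow> 'a) \<Rightarrow> 'a mat" where
  "B_mat m x = mat m m (\<lambda>(p, q). x (max (Suc p) (Suc q)))"

text \<open>
  Row \<open>a\<close> of the \<open>N * m\<close> rows is row \<open>a mod m\<close> within block row \<open>a div m\<close> (counting from 0);
  likewise for columns.
\<close>

definition B_block :: "nat \<Rightarrow> nat \<Rightarrow> (nat \<Rightarrow> nat \<Rightarrow> nat \<Rightarrow> 'a) \<Rightarrow> 'a mat" where
  "B_block N m x = mat (N * m) (N * m)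
     (\<lambda>(a, b). B_mat m (x (Suc (a div m)) (Suc (b div m))) $$ (a mod m, b mod m))"

definition X_diff :: "nat \<Rightarrow> (nat \<Rightarrow> nat \<Rightarrow> nat \<Rightarrow> 'a :: comm_ring_1) \<Rightarrow> nat \<Rightarrow> 'a mat" where
  "X_diff N x i = mat N N (\<lambda>(r, s). x (Suc r) (Suc s) i - x (Suc r) (Suc s) (Suc i))"

end

theory Submission
  imports Defs
begin

text \<open>
  Telescoping from \<open>x\<^sub>m\<^sub>+\<^sub>1 = 0\<close> gives \<open>B\<^sub>m(x) = U D U\<^sup>T\<close>, where \<open>U\<close> is the upper triangular
  all-ones matrix and \<open>D\<close> is diagonal with entries \<open>x\<^sub>k - x\<^sub>k\<^sub>+\<^sub>1\<close>. Since \<open>U\<close> does not depend on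
  \<open>x\<close>, the same holds blockwise, with \<open>N\<close> diagonal copies of \<open>U\<close> on both sides. The middle
  factor consists of diagonal blocks; interchanging the block index and the index within a block
  turns it into the block diagonal matrix with blocks \<open>X\<^sub>(\<^sub>i\<^sub>,\<^sub>i\<^sub>+\<^sub>1\<^sub>)\<close>.
\<close>

section \<open>Determinants of block diagonal matrices over a commutative ring\<close>

definition block_diag :: "nat \<Rightarrow> nat \<Rightarrow> (nat \<Rightarrow> 'a :: zero mat) \<Rightarrow> 'a mat" where
  "block_diag m n A = mat (m * n) (m * n)
     (\<lambda>(a, b). if a div n = b div n then A (a div n) $$ (a mod n, b mod n) else 0)"

lemma block_diag_carrier [simp]: "block_diag m n A \<in> carrier_mat (m * n) (m * n)"
  by (simp add: block_diag_def)

text \<open>Induction on \<open>k\<close>: the last column is zero above a corner entry 1, so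
  splitting off one row and one column leaves the determinant unchanged over any commutative
  ring.\<close>

lemma det_four_block_mat_one_lower:
  fixes A :: "'a :: comm_ring_1 mat"
  assumes A: "A \<in> carrier_mat n n"
  shows "det (four_block_mat A (0\<^sub>m n k) (0\<^sub>m k n) (1\<^sub>m k)) = det A"
proof (induction k)
  case 0
  have "four_block_mat A (0\<^sub>m n 0) (0\<^sub>m 0 n) (1\<^sub>m 0) = A"
    using A by (intro eq_matI) auto
  then show ?case by simp
next
  case (Suc k)
  let ?B = "four_block_mat A (0\<^sub>m n k) (0\<^sub>m k n) (1\<^sub>m k)"
  have B: "?B \<in> carrier_mat (n + k) (n + k)"
    using A by auto
  have "four_block_mat A (0\<^sub>m n (Suc k)) (0\<^sub>m (Suc k) n) (1\<^sub>m (Suc k))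
      = four_block_mat ?B (0\<^sub>m (n + k) 1) (0\<^sub>m 1 (n + k)) (1\<^sub>m 1)"
    using A by (intro eq_matI) auto
  then show ?case
    using det_four_block_mat_upper_right_zero_col[OF B refl zero_carrier_mat one_carrier_mat] Suc
    by simp
qed

lemma det_four_block_mat_one_upper:
  fixes D :: "'a :: comm_ring_1 mat"
  assumes D: "D \<in> carrier_mat n n"
  shows "det (four_block_mat (1\<^sub>m k) (0\<^sub>m k n) (0\<^sub>m n k) D) = det D"
proof (induction k)
  case 0
  have "four_block_mat (1\<^sub>m 0) (0\<^sub>m 0 n) (0\<^sub>m n 0) D = D"
    using D by (intro eq_matI) auto
  then show ?case by simp
next
  case (Suc k)
  let ?B = "four_block_mat (1\<^sub>m k) (0\<^sub>m k n) (0\<^sub>m n k) D"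
  have B: "?B \<in> carrier_mat (k + n) (k + n)"
    using D by auto
  have "four_block_mat (1\<^sub>m (Suc k)) (0\<^sub>m (Suc k) n) (0\<^sub>m n (Suc k)) D
      = four_block_mat (1\<^sub>m 1) (0\<^sub>m 1 (k + n)) (0\<^sub>m (k + n) 1) ?B"
    using D by (intro eq_matI) auto
  then show ?case
    using det_four_block_mat_lower_left_zero_col[OF one_carrier_mat zero_carrier_mat refl B] Suc
    by simp
qed

text \<open>
  The library's \<open>det_four_block_mat_upper_right_zero\<close> is restricted to integral domains; here the
  two diagonal blocks are split multiplicatively instead.
\<close>

lemma det_four_block_mat_diag:
  fixes A D :: "'a :: comm_ring_1 mat"
  assumes A: "A \<in> carrier_mat n n" and D: "D \<in> carrier_mat k k"
  shows "det (four_block_mat A (0\<^sub>m n k) (0\<^sub>m k n) D) = det A * det D"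
proof -
  let ?A = "four_block_mat A (0\<^sub>m n k) (0\<^sub>m k n) (1\<^sub>m k)"
  let ?D = "four_block_mat (1\<^sub>m n) (0\<^sub>m n k) (0\<^sub>m k n) D"
  have "?A * ?D = four_block_mat A (0\<^sub>m n k) (0\<^sub>m k n) D"
    using A D by (subst mult_four_block_mat[where ?nr1.0 = n and ?n1.0 = n and ?n2.0 = k
          and ?nr2.0 = k and ?nc1.0 = n and ?nc2.0 = k]) auto
  moreover have "det (?A * ?D) = det ?A * det ?D"
    using A D by (intro det_mult[where n = "n + k"]) auto
  ultimately show ?thesis
    using det_four_block_mat_one_lower[OF A] det_four_block_mat_one_upper[OF D] by simp
qed

lemma det_block_diag:
  fixes A :: "nat \<Rightarrow> 'a :: comm_ring_1 mat"
  assumes "\<And>i. i < m \<Longrightarrow> A i \<in> carrier_mat n n"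
  shows "det (block_diag m n A) = (\<Prod>i<m. det (A i))"
  using assms
proof (induction m)
  case 0
  then show ?case by (simp add: block_diag_def det_dim_zero)
next
  case (Suc m)
  have Am: "A m \<in> carrier_mat n n"
    using Suc.prems by simp
  have "block_diag (Suc m) n A
      = four_block_mat (block_diag m n A) (0\<^sub>m (m * n) n) (0\<^sub>m n (m * n)) (A m)"
    (is "?L = ?R")
  proof (rule eq_matI)
    fix a b
    assume "a < dim_row ?R" and "b < dim_col ?R"
    then have ab: "a < m * n + n" "b < m * n + n"
      using Am by (auto simp: block_diag_def)
    \<comment> \<open>Indices past \<open>m * n\<close> have quotient exactly \<open>m\<close>, the
      earlier ones a smaller quotient; hence the two off-diagonal corners vanish.\<close>
    have last: "c div n = m \<and> c mod n = c - m * n" if "\<not> c < m * n" "c < m * n + n" for c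
    proof -
      have "c = m * n + (c - m * n)" "c - m * n < n"
        using that by auto
      then show ?thesis
        by (metis add.commute div_mult_self3 div_less mod_less mod_mult_self3 add_0_right
            gr_implies_not_zero)
    qed
    have first: "c div n < m" if "c < m * n" for c
      using that by (simp add: less_mult_imp_div_less)
    show "?L $$ (a, b) = ?R $$ (a, b)"
    proof (cases "a < m * n"; cases "b < m * n")
      assume "a < m * n" "b < m * n"
      then show ?thesis using ab Am by (simp add: block_diag_def)
    next
      assume "a < m * n" "\<not> b < m * n"
      then show ?thesis
        using ab Am first[of a] last[of b] by (simp add: block_diag_def)
    next
      assume "\<not> a < m * n" "b < m * n"
      then show ?thesis
        using ab Am last[of a] first[of b] by (simp add: block_diag_def)
    next
      assume "\<not> a < m * n" "\<not> b < m * n"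
      then show ?thesis
        using ab Am last[of a] last[of b] by (simp add: block_diag_def)
    qed
  qed (use Am in \<open>auto simp: block_diag_def\<close>)
  then show ?case
    using Suc det_four_block_mat_diag[OF block_diag_carrier Am] by simp
qed

section \<open>Permuting rows and columns, and index arithmetic for blocks\<close>

text \<open>Rows and columns undergo the same permutation, so its sign enters twice and
  cancels.\<close>

lemma det_reindex:
  fixes A :: "'a :: comm_ring_1 mat"
  assumes A: "A \<in> carrier_mat n n" and f: "bij_betw f {0..<n} {0..<n}"
  shows "det (mat n n (\<lambda>(i, j). A $$ (f i, f j))) = det A"
proof -
  \<comment> \<open>\<open>permutes\<close> demands the identity outside \<open>{0..<n}\<close>,
    where nothing is known about \<open>f\<close>.\<close>
  define p where "p i = (if i \<in> {0..<n} then f i else i)" for i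
  have "bij_betw p {0..<n} {0..<n}"
    using f by (subst bij_betw_cong[of _ _ f]) (auto simp: p_def)
  then have p: "p permutes {0..<n}"
    by (rule bij_imp_permutes) (auto simp: p_def)
  define R where "R = mat n n (\<lambda>(i, j). A $$ (p i, j))"
  have p_less: "p i < n" if "i < n" for i
    using permutes_in_image[OF p, of i] that by simp
  \<comment> \<open>The columns are permuted as rows of the transpose of \<open>R\<close>, whose own
    rows are permuted already.\<close>
  have "mat n n (\<lambda>(i, j). A $$ (f i, f j))
      = transpose_mat (mat n n (\<lambda>(i, j). transpose_mat R $$ (p i, j)))"
    using A p_less by (intro eq_matI) (auto simp: R_def p_def)
  then have "det (mat n n (\<lambda>(i, j). A $$ (f i, f j)))
      = det (mat n n (\<lambda>(i, j). transpose_mat R $$ (p i, j)))"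
    by (simp add: det_transpose[where n = n])
  also have "\<dots> = signof p * det (transpose_mat R)"
    by (rule det_permute_rows[OF _ p]) (simp add: R_def)
  also have "det (transpose_mat R) = det R"
    by (rule det_transpose[where n = n]) (simp add: R_def)
  also have "det R = signof p * det A"
    unfolding R_def by (rule det_permute_rows[OF A p])
  finally show ?thesis
    by (simp add: sign_def flip: mult.assoc)
qed

lemma mult_add_less_mult:
  fixes r k m N :: nat
  assumes "r < N" "k < m"
  shows "r * m + k < N * m"
proof -
  have "r * m + k < Suc r * m" using assms by simp
  also have "\<dots> \<le> N * m" using assms by (intro mult_le_mono1) simp
  finally show ?thesis .
qed

text \<open>A perfect shuffle: \<open>k * N + r\<close> goes to \<open>r * m + k\<close> for
  \<open>r < N\<close> and \<open>k < m\<close>. Its inverse is the same map with \<open>N\<close>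
  and \<open>m\<close> exchanged, so one computation with generic \<open>K\<close> and
  \<open>l\<close> serves both directions.\<close>

lemma bij_betw_swap_div_mod:
  fixes m N :: nat
  shows "bij_betw (\<lambda>a. (a mod N) * m + a div N) {0..<N * m} {0..<N * m}"
proof -
  have range: "(a mod K) * l + a div K < K * l" and inverse:
    "((a mod K) * l + a div K) mod l * K + ((a mod K) * l + a div K) div l = a"
    if "a < K * l" for a K l :: nat
  proof -
    have "K > 0" and "a div K < l"
      using that by (auto simp: less_mult_imp_div_less mult.commute intro: gr0I)
    then show "(a mod K) * l + a div K < K * l"
      and "((a mod K) * l + a div K) mod l * K + ((a mod K) * l + a div K) div l = a"
      by (auto intro: mult_add_less_mult)
  qed
  show ?thesis
    by (rule bij_betw_byWitness[where f' = "\<lambda>a. (a mod m) * N + a div m"])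
      (use range[of _ N m] range[of _ m N] inverse[of _ N m] inverse[of _ m N]
        in \<open>auto simp: mult.commute[of m N]\<close>)
qed

text \<open>Used for matrix products in which one factor vanishes outside block \<open>r\<close>:
  the sum over all \<open>N * m\<close> inner indices collapses to that block.\<close>

lemma sum_div_block:
  fixes g :: "nat \<Rightarrow> 'a :: comm_monoid_add"
  assumes "r < N"
  shows "(\<Sum>c = 0..<N * m. if c div m = r then g (c mod m) else 0) = (\<Sum>k = 0..<m. g k)"
proof -
  have "(\<Sum>c = 0..<N * m. if c div m = r then g (c mod m) else 0)
      = (\<Sum>c | c < N * m \<and> c div m = r. g (c mod m))"
    by (simp add: sum.If_cases Int_def)
  also have "\<dots> = (\<Sum>k = 0..<m. g k)"
  proof (rule sum.reindex_bij_witness[where i = "\<lambda>k. r * m + k" and j = "\<lambda>c. c mod m"])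
    fix c assume "c \<in> {c. c < N * m \<and> c div m = r}"
    then have c: "c < N * m" "c div m = r" by auto
    show "r * m + c mod m = c"
      using c by (metis div_mult_mod_eq)
    show "c mod m \<in> {0..<m}"
      using c by (cases "m = 0") auto
  qed (use assms mult_add_less_mult in auto)
  finally show ?thesis .
qed

section \<open>The factors of the block matrix and their product\<close>

definition ones_upper :: "nat \<Rightarrow> nat \<Rightarrow> 'a :: comm_ring_1 mat" where
  "ones_upper N m = mat (N * m) (N * m)
     (\<lambda>(a, b). if b div m = a div m \<and> a mod m \<le> b mod m then 1 else 0)"

definition diag_blocks ::
    "nat \<Rightarrow> nat \<Rightarrow> (nat \<Rightarrow> nat \<Rightarrow> nat \<Rightarrow> 'a :: comm_ring_1) \<Rightarrow> 'a mat" where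
  "diag_blocks N m d = mat (N * m) (N * m)
     (\<lambda>(a, b). if a mod m = b mod m then d (a div m) (b div m) (a mod m) else 0)"

lemma det_ones_upper: "det (ones_upper N m :: 'a :: comm_ring_1 mat) = 1"
proof -
  have "upper_triangular (ones_upper N m :: 'a mat)"
  proof (rule upper_triangularI)
    fix i j
    assume "j < i" and "i < dim_row (ones_upper N m :: 'a mat)"
    then show "(ones_upper N m :: 'a mat) $$ (i, j) = 0"
      \<comment> \<open>Equal quotients and \<open>i mod m \<le> j mod m\<close> would force
        \<open>i \<le> j\<close>; so the matrix is triangular as a whole, not only within
        blocks.\<close>
      by (simp add: ones_upper_def) (metis add_le_cancel_left div_mult_mod_eq not_le)
  qed
  then have "det (ones_upper N m :: 'a mat) = prod_list (diag_mat (ones_upper N m :: 'a mat))"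
    by (rule det_upper_triangular[where n = "N * m"]) (simp add: ones_upper_def)
  also have "\<dots> = 1"
    by (simp add: prod_list_diag_prod ones_upper_def)
  finally show ?thesis .
qed

text \<open>After the shuffle, the inner index \<open>a mod m\<close> becomes the block index
  \<open>a div N\<close>, so equality of remainders turns into membership in the same diagonal
  block.\<close>

lemma det_diag_blocks:
  "det (diag_blocks N m d) = (\<Prod>k<m. det (mat N N (\<lambda>(r, s). d r s k)))"
proof -
  let ?f = "\<lambda>a. (a mod N) * m + a div N"
  have "mat (N * m) (N * m) (\<lambda>(a, b). diag_blocks N m d $$ (?f a, ?f b))
      = block_diag m N (\<lambda>k. mat N N (\<lambda>(r, s). d r s k))"
  proof (rule eq_matI)
    fix a b
    assume "a < dim_row (block_diag m N (\<lambda>k. mat N N (\<lambda>(r, s). d r s k)))"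
      and "b < dim_col (block_diag m N (\<lambda>k. mat N N (\<lambda>(r, s). d r s k)))"
    then have ab: "a < N * m" "b < N * m"
      by (simp_all add: block_diag_def mult.commute)
    then have "N > 0" "a div N < m" "b div N < m"
      by (auto simp: less_mult_imp_div_less mult.commute intro: gr0I)
    moreover from this have "?f a < N * m" "?f b < N * m"
      by (auto intro: mult_add_less_mult)
    ultimately show "mat (N * m) (N * m) (\<lambda>(a, b). diag_blocks N m d $$ (?f a, ?f b)) $$ (a, b)
        = block_diag m N (\<lambda>k. mat N N (\<lambda>(r, s). d r s k)) $$ (a, b)"
      using ab by (simp add: diag_blocks_def block_diag_def mult.commute[of m N])
  qed (simp_all add: block_diag_def)
  moreover have "diag_blocks N m d \<in> carrier_mat (N * m) (N * m)"
    by (simp add: diag_blocks_def)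
  ultimately show ?thesis
    using det_reindex[OF _ bij_betw_swap_div_mod, of "diag_blocks N m d" N m]
    by (simp add: det_block_diag)
qed

lemma ones_upper_mult_diag_blocks:
  "ones_upper N m * diag_blocks N m d = mat (N * m) (N * m)
     (\<lambda>(a, b). if a mod m \<le> b mod m then d (a div m) (b div m) (b mod m) else 0)"
  (is "?L = ?R")
proof (rule eq_matI)
  fix a b
  assume "a < dim_row ?R" and "b < dim_col ?R"
  then have ab: "a < N * m" "b < N * m" by simp_all
  then have a: "a div m < N" and b: "b mod m < m"
    by (auto simp: less_mult_imp_div_less intro!: mod_less_divisor gr0I)
  have "?L $$ (a, b) = (\<Sum>c = 0..<N * m. if c div m = a div m then
      (if a mod m \<le> c mod m \<and> c mod m = b mod m then d (a div m) (b div m) (c mod m) else 0) else 0)"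
    using ab by (auto simp: ones_upper_def diag_blocks_def scalar_prod_def intro!: sum.cong)
  also have "\<dots> = (\<Sum>k = 0..<m. if a mod m \<le> k \<and> k = b mod m then d (a div m) (b div m) k else 0)"
    by (rule sum_div_block[OF a])
  \<comment> \<open>Isolating \<open>k = b mod m\<close> as the outer condition makes this a sum
    with a single nonzero candidate.\<close>
  also have "\<dots> = (\<Sum>k = 0..<m. if k = b mod m then
      (if a mod m \<le> k then d (a div m) (b div m) k else 0) else 0)"
    by (intro sum.cong) auto
  also have "\<dots> = ?R $$ (a, b)"
    using ab b by simp
  finally show "?L $$ (a, b) = ?R $$ (a, b)" .
qed (simp_all add: ones_upper_def diag_blocks_def)

text \<open>The left factor forces \<open>a mod m \<le> k\<close> and the transposed one
  \<open>b mod m \<le> k\<close>; together they produce the maximum that defines the entries of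
  \<open>B_mat\<close>.\<close>

lemma ones_upper_diag_blocks_transpose:
  "ones_upper N m * diag_blocks N m d * transpose_mat (ones_upper N m) = mat (N * m) (N * m)
     (\<lambda>(a, b). \<Sum>k = max (a mod m) (b mod m)..<m. d (a div m) (b div m) k)"
  (is "?L = ?R")
proof (rule eq_matI)
  fix a b
  assume "a < dim_row ?R" and "b < dim_col ?R"
  then have ab: "a < N * m" "b < N * m" by simp_all
  then have b: "b div m < N"
    by (simp add: less_mult_imp_div_less)
  have "?L $$ (a, b) = (\<Sum>c = 0..<N * m. if c div m = b div m then
      (if max (a mod m) (b mod m) \<le> c mod m then d (a div m) (b div m) (c mod m) else 0) else 0)"
    unfolding ones_upper_mult_diag_blocks
    using ab by (auto simp: ones_upper_def scalar_prod_def intro!: sum.cong)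
  also have "\<dots> = (\<Sum>k = 0..<m. if max (a mod m) (b mod m) \<le> k then d (a div m) (b div m) k else 0)"
    by (rule sum_div_block[OF b])
  also have "\<dots> = (\<Sum>k = max (a mod m) (b mod m)..<m. d (a div m) (b div m) k)"
    by (rule sum.mono_neutral_cong_right) auto
  finally show "?L $$ (a, b) = ?R $$ (a, b)"
    using ab by simp
qed (simp_all add: ones_upper_def)

theorem theorem2p2:
  fixes N m :: nat
    and x :: "nat \<Rightarrow> nat \<Rightarrow> nat \<Rightarrow> 'a :: comm_ring_1"
  assumes "N \<ge> 2" and "m \<ge> 1"
    and "\<And>r s. r \<in> {1..N} \<Longrightarrow> s \<in> {1..N} \<Longrightarrow> x r s (m + 1) = 0"
  shows "det (B_block N m x) = (\<Prod>i = 1..m. det (X_diff N x i))"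
proof -
  define d where
    "d r s k = x (Suc r) (Suc s) (Suc k) - x (Suc r) (Suc s) (Suc (Suc k))" for r s k
  let ?U = "ones_upper N m :: 'a mat"
  let ?D = "diag_blocks N m d"
  have U: "?U \<in> carrier_mat (N * m) (N * m)" and D: "?D \<in> carrier_mat (N * m) (N * m)"
    by (simp_all add: ones_upper_def diag_blocks_def)
  have telescope: "(\<Sum>k = j..<m. d r s k) = x (Suc r) (Suc s) (Suc j)"
    if "r < N" "s < N" "j < m" for r s j
  proof -
    \<comment> \<open>The sign is flipped to match \<open>sum_Suc_diff'\<close>. The end term left
      over is the entry with index \<open>m + 1\<close>, which is zero by assumption.\<close>
    have "(\<Sum>k = j..<m. d r s k)
        = - (\<Sum>k = j..<m. x (Suc r) (Suc s) (Suc (Suc k)) - x (Suc r) (Suc s) (Suc k))"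
      by (simp add: d_def flip: sum_negf)
    also have "\<dots> = x (Suc r) (Suc s) (Suc j)"
      using that assms(3)[of "Suc r" "Suc s"]
      by (simp add: sum_Suc_diff'[where f = "\<lambda>k. x (Suc r) (Suc s) (Suc k)"])
    finally show ?thesis .
  qed
  have "B_block N m x = ?U * ?D * transpose_mat ?U"
    unfolding ones_upper_diag_blocks_transpose B_block_def
  proof (rule cong_mat[OF refl refl])
    fix a b
    assume "a < N * m" and "b < N * m"
    then have "a div m < N" "b div m < N" "a mod m < m" "b mod m < m"
      using assms(2) by (auto simp: less_mult_imp_div_less)
    then show "(case (a, b) of (a, b) \<Rightarrow>
          B_mat m (x (Suc (a div m)) (Suc (b div m))) $$ (a mod m, b mod m))
        = (case (a, b) of (a, b) \<Rightarrow>
          \<Sum>k = max (a mod m) (b mod m)..<m. d (a div m) (b div m) k)"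
      by (simp add: telescope B_mat_def)
  qed
  also have "det (?U * ?D * transpose_mat ?U) = det ?U * det ?D * det ?U"
    using U D by (simp add: det_mult[where n = "N * m"] det_transpose)
  also have "\<dots> = (\<Prod>k<m. det (X_diff N x (Suc k)))"
    by (simp add: det_ones_upper det_diag_blocks X_diff_def d_def)
  also have "\<dots> = (\<Prod>i = 1..m. det (X_diff N x i))"
    by (simp add: prod.atLeast1_atMost_eq)
  finally show ?thesis .
qed

end
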